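(* For every integer $s \geq 2$ there exist infinitely many (pairwise non-isomorphic) $2$-designs $\mathscr{D}=(\mathscr{P},\mathscr{B})$ (with block size $k$ satisfying $2\le k<|\mathscr{P}|$) such that some subgroup $G\leq \mathrm{Aut}(\mathscr{D})$ acts flag-transitively on $\mathscr{D}$ and $s$-chain-imprimitively on $\mathscr{P}$.
   Context: A $2$-$(v,k,\lambda)$ design is a pair $\mathscr{D}=(\mathscr{P},\mathscr{B})$ where $\mathscr{P}$ is a finite set of $v$ points, $\mathscr{B}$ is a nonempty set of $k$-element subsets of $\mathscr{P}$ (blocks), and any two distinct points are contained in exactly $\lambda$ blocks; a $2$-design is a $2$-$(v,k,\lambda)$ design for some $v,k,\lambda$. $\mathrm{Aut}(\mathscr{D})$ is the group of permutations of $\mathscr{P}$ that map $\mathscr{B}$ to itself. A flag is a pair $(\delta,B)\in\mathscr{P}\times\mathscr{B}$ with $\delta\in B$; $G\le\mathrm{Aut}(\mathscr{D})$ is flag-transitive if it is transitive on the set of flags. For partitions of $\mathscr{P}$, $\mathscr{C}\prec\mathscr{C}'$ means that each $\mathscr{C}$-class is a proper subset of some $\mathscr{C}'$-class. $G$ acts $s$-chain-imprimitively on $\mathscr{P}$ if $G$ is transitive on $\mathscr{P}$ and leaves invariant each partition in some chain of partitions $\mathscr{C}_0\prec\mathscr{C}_1\prec\cdots\prec\mathscr{C}_s$ of $\mathscr{P}$, where $\mathscr{C}_0$ is the partition into singletons and $\mathscr{C}_s=\{\mathscr{P}\}$. *)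

theory Defs
  imports "HOL-Algebra.Group_Action" "HOL-Library.Disjoint_Sets"
begin

type_synonym 'a incidence = "'a set \<times> 'a set set"

abbreviation points :: "'a incidence \<Rightarrow> 'a set" where
  "points D \<equiv> fst D"

abbreviation blocks :: "'a incidence \<Rightarrow> 'a set set" where
  "blocks D \<equiv> snd D"

text \<open>Blocks form a set, so there are no repeated blocks.\<close>

definition two_design :: "nat \<Rightarrow> nat \<Rightarrow> nat \<Rightarrow> 'a incidence \<Rightarrow> bool" where
  "two_design v k l D \<longleftrightarrow>
     finite (points D) \<and> card (points D) = v \<and>
     blocks D \<noteq> {} \<and>
     (\<forall>B \<in> blocks D. B \<subseteq> points D \<and> card B = k) \<and>
     (\<forall>x \<in> points D. \<forall>y \<in> points D. x \<noteq> y \<longrightarrow>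
        card {B \<in> blocks D. x \<in> B \<and> y \<in> B} = l)"

definition design_isomorphic :: "'a incidence \<Rightarrow> 'b incidence \<Rightarrow> bool" where
  "design_isomorphic D D' \<longleftrightarrow>
     (\<exists>f. bij_betw f (points D) (points D') \<and> (\<lambda>B. f ` B) ` blocks D = blocks D')"

text \<open>As in \<^const>\<open>BijGroup\<close>, permutations of the point set are extensional functions.\<close>

definition Aut :: "'a incidence \<Rightarrow> ('a \<Rightarrow> 'a) monoid" where
  "Aut D = (BijGroup (points D))
     \<lparr>carrier := {g \<in> Bij (points D). (\<lambda>B. g ` B) ` blocks D = blocks D}\<rparr>"

definition flags :: "'a incidence \<Rightarrow> ('a \<times> 'a set) set" where
  "flags D = {(x, B). x \<in> points D \<and> B \<in> blocks D \<and> x \<in> B}"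

text \<open>The locale \<^locale>\<open>group_action\<close> requires each group element to act as an
  extensional function; hence the restriction to the flags.\<close>

definition flag_transitive :: "('a \<Rightarrow> 'a) set \<Rightarrow> 'a incidence \<Rightarrow> bool" where
  "flag_transitive G D \<longleftrightarrow>
     transitive_action ((Aut D)\<lparr>carrier := G\<rparr>) (flags D)
       (\<lambda>g. \<lambda>F \<in> flags D. (g (fst F), g ` snd F))"


definition finer :: "'a set set \<Rightarrow> 'a set set \<Rightarrow> bool"  (infix "\<prec>\<prec>" 50) where
  "\<C> \<prec>\<prec> \<C>' \<longleftrightarrow> (\<forall>C \<in> \<C>. \<exists>C' \<in> \<C>'. C \<subset> C')"

definition chain_imprimitive :: "nat \<Rightarrow> ('a \<Rightarrow> 'a) set \<Rightarrow> 'a set \<Rightarrow> bool" where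
  "chain_imprimitive s G P \<longleftrightarrow>
     transitive_action ((BijGroup P)\<lparr>carrier := G\<rparr>) P (\<lambda>g. g) \<and>
     (\<exists>\<C> :: nat \<Rightarrow> 'a set set.
        (\<forall>i \<le> s. partition_on P (\<C> i) \<and> (\<forall>g \<in> G. (\<lambda>C. g ` C) ` \<C> i = \<C> i)) \<and>
        \<C> 0 = (\<lambda>x. {x}) ` P \<and> \<C> s = {P} \<and>
        (\<forall>i < s. \<C> i \<prec>\<prec> \<C> (Suc i)))"

end

theory Submission
  imports Defs
begin

text \<open>
  Let \<open>G\<close> be the full stabilizer of a chain of partitions of \<open>P\<close> in which all classes of level \<open>i\<close>
  have size \<open>c i\<close>, and take as blocks all nonempty \<open>B\<close> whose intersection with a class of level \<open>i\<close>
  is empty or of size \<open>k i\<close>. By matching class trees recursively, \<open>G\<close> is transitive on flags, and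
  on the pairs of points that are first joined at level \<open>i\<close>, for each \<open>i\<close>. Double counting shows that
  this is a \<open>2\<close>-design as soon as \<open>c (i + 1) - c i = t * (k (i + 1) - k i)\<close> for a constant \<open>t\<close>,
  and such sequences exist for each \<open>t \<ge> 2\<close>. The points are numbers, the classes of level \<open>i\<close> being
  given by the quotients \<open>x div c i\<close>.
\<close>

section \<open>Regular sets and isomorphisms of class trees\<close>

text \<open>The bijection is built from the inside out, each extension matching complements of equal
  size. In the recursion on class trees, \<open>A\<close>, \<open>B\<close> and \<open>X\<close> are
  the sets of children of a node met by three nested sets of points.\<close>

lemma ex_bij_betw_chain:
  assumes fin: "finite A" "finite A'" and sub: "X \<subseteq> B" "B \<subseteq> A" "X' \<subseteq> B'" "B' \<subseteq> A'"
    and card: "card A = card A'" "card B = card B'" "card X = card X'"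
  shows "\<exists>f. bij_betw f A A' \<and> f ` B = B' \<and> f ` X = X'"
proof -
  have extend: "\<exists>g. bij_betw g T T' \<and> (\<forall>y\<in>S. g y = f y)"
    if "finite T" "finite T'" "S \<subseteq> T" "S' \<subseteq> T'" "card T = card T'" "bij_betw f S S'"
    for f S S' T T'
  proof -
    have "card (T - S) = card (T' - S')"
      using that bij_betw_same_card[OF that(6)] by (simp add: card_Diff_subset finite_subset)
    then have "\<exists>h. bij_betw h (T - S) (T' - S')"
      by (intro finite_same_card_bij finite_Diff that)
    then obtain h where h: "bij_betw h (T - S) (T' - S')" by blast
    have "bij_betw (\<lambda>y. if y \<in> S then f y else h y) (S \<union> (T - S)) (S' \<union> (T' - S'))"
      by (rule bij_betw_disjoint_Un[OF that(6) h]) auto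
    then have "bij_betw (\<lambda>y. if y \<in> S then f y else h y) T T'"
      using that by (simp add: Un_absorb1)
    then show ?thesis by (intro exI[of _ "\<lambda>y. if y \<in> S then f y else h y"]) simp
  qed
  have finB: "finite B" "finite B'" "finite X" "finite X'"
    using fin sub by (meson finite_subset)+
  then obtain f where f: "bij_betw f X X'"
    using card by (meson finite_same_card_bij)
  obtain g where g: "bij_betw g B B'" "\<forall>y\<in>X. g y = f y"
    using extend[OF finB(1,2) sub(1,3) card(2) f] by blast
  obtain h where h: "bij_betw h A A'" "\<forall>y\<in>B. h y = g y"
    using extend[OF fin sub(2,4) card(1) g(1)] by blast
  have "h ` B = B'"
    using h(2) g(1) by (simp add: bij_betw_def cong: image_cong)
  moreover have "h ` X = X'"
  proof -
    have "h ` X = f ` X"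
      using h(2) g(2) sub(1) by (intro image_cong) auto
    then show ?thesis using f by (simp add: bij_betw_def)
  qed
  ultimately show ?thesis using h(1) by blast
qed

text \<open>\<open>q i x\<close> labels the class of level \<open>i\<close> containing
  \<open>x\<close>, so equality of labels replaces explicit partitions. The point set, blocks,
  single points and pairs are all regular, which lets one isomorphism lemma serve for all of them.
  The empty set is regular for every \<open>k\<close>.\<close>

definition regular :: "(nat \<Rightarrow> 'a \<Rightarrow> 'b) \<Rightarrow> nat \<Rightarrow> (nat \<Rightarrow> nat) \<Rightarrow> 'a set \<Rightarrow> bool" where
  "regular q n k B \<longleftrightarrow> finite B \<and> (\<forall>i\<le>n. \<forall>x\<in>B. card {y \<in> B. q i y = q i x} = k i)"

text \<open>By nestedness, a class of level at most \<open>n\<close> through a point of the child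
  lies inside the child, so restricting to the child loses none of the points counted.\<close>

lemma regular_subclass:
  assumes "regular q (Suc n) k B" and "\<And>i x y. \<lbrakk>i \<le> n; q i x = q i y\<rbrakk> \<Longrightarrow> q n x = q n y"
  shows "regular q n k {y \<in> B. q n y = b}"
  unfolding regular_def
proof (intro conjI allI impI ballI)
  show "finite {y \<in> B. q n y = b}" using assms(1) by (simp add: regular_def)
  fix i x assume i: "i \<le> n" and x: "x \<in> {y \<in> B. q n y = b}"
  have "{y \<in> {y \<in> B. q n y = b}. q i y = q i x} = {y \<in> B. q i y = q i x}"
    using x assms(2)[OF i, of _ x] by (intro Collect_cong) (metis (mono_tags, lifting) mem_Collect_eq)
  then show "card {y \<in> {y \<in> B. q n y = b}. q i y = q i x} = k i"
    using assms(1) i x by (auto simp: regular_def)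
qed

lemma card_regular:
  assumes B: "regular q n k B" and i: "i \<le> n"
  shows "card B = card (q i ` B) * k i"
proof -
  have "card B = (\<Sum>b\<in>q i ` B. card {y \<in> B. q i y = b})"
    using sum.image_gen[of B "\<lambda>_. 1::nat" "q i"] B by (simp add: regular_def)
  also have "\<dots> = (\<Sum>b\<in>q i ` B. k i)"
    using B i by (intro sum.cong) (auto simp: regular_def)
  finally show ?thesis by simp
qed

lemma regular_card_top:
  assumes "regular q n k B" "B \<noteq> {}" "\<And>x y. \<lbrakk>x \<in> B; y \<in> B\<rbrakk> \<Longrightarrow> q n x = q n y"
  shows "card B = k n"
proof -
  obtain x where x: "x \<in> B" using assms(2) by blast
  have "{y \<in> B. q n y = q n x} = B" using assms(3)[OF _ x] by blast
  then show ?thesis using assms(1) x unfolding regular_def by (metis order_refl)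
qed

text \<open>A nonempty set inside one class of level \<open>Suc n\<close> has
  \<open>k (Suc n)\<close> points, with \<open>k n\<close> of them in each child it meets, so
  \<open>k\<close> alone determines the number of these children.\<close>

lemma regular_children_card:
  assumes B: "regular q (Suc n) k B" "\<And>x y. \<lbrakk>x \<in> B; y \<in> B\<rbrakk> \<Longrightarrow> q (Suc n) x = q (Suc n) y"
    and B': "regular q (Suc n) k B'" "\<And>x y. \<lbrakk>x \<in> B'; y \<in> B'\<rbrakk> \<Longrightarrow> q (Suc n) x = q (Suc n) y"
    and empty: "B = {} \<longleftrightarrow> B' = {}"
  shows "card (q n ` B) = card (q n ` B')"
proof (cases "B = {}")
  case True
  then show ?thesis using empty by simp
next
  case False
  have "B' \<noteq> {}" using False empty by simp
  have top: "card B = k (Suc n)" "card B' = k (Suc n)"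
    by (rule regular_card_top[OF B(1) False B(2)], assumption+)
      (rule regular_card_top[OF B'(1) \<open>B' \<noteq> {}\<close> B'(2)], assumption+)
  have "card B > 0"
    using False B(1) by (simp add: card_gt_0_iff regular_def)
  moreover have prod: "card B = card (q n ` B) * k n" "card B' = card (q n ` B') * k n"
    using card_regular[OF B(1)] card_regular[OF B'(1)] by auto
  ultimately have "k n \<noteq> 0" by (intro notI) simp
  moreover have "card (q n ` B) * k n = card (q n ` B') * k n" using top prod by simp
  ultimately show ?thesis by simp
qed

text \<open>The isomorphism is built from the root of the class tree: match the children, sending those
  meeting \<open>B\<close> to those meeting \<open>B'\<close> and those meeting \<open>X\<close> to those meeting \<open>X'\<close>, and recurse.\<close>

lemma regular_isomorphism:
  fixes q :: "nat \<Rightarrow> 'a \<Rightarrow> 'b"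
  assumes nested: "\<And>i j x y. \<lbrakk>i \<le> j; q i x = q i y\<rbrakk> \<Longrightarrow> q j x = q j y"
  assumes "regular q n c A" "regular q n c A'" "regular q n k B" "regular q n k B'"
    "regular q n m X" "regular q n m X'"
    "X \<subseteq> B" "B \<subseteq> A" "X' \<subseteq> B'" "B' \<subseteq> A'"
    "A = {} \<longleftrightarrow> A' = {}" "B = {} \<longleftrightarrow> B' = {}" "X = {} \<longleftrightarrow> X' = {}"
    "\<And>u v. \<lbrakk>u \<in> A; v \<in> A\<rbrakk> \<Longrightarrow> q n u = q n v" "\<And>u v. \<lbrakk>u \<in> A'; v \<in> A'\<rbrakk> \<Longrightarrow> q n u = q n v"
  shows "\<exists>g. bij_betw g A A' \<and> g ` B = B' \<and> g ` X = X' \<and>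
    (\<forall>i\<le>n. \<forall>u\<in>A. \<forall>v\<in>A. q i u = q i v \<longleftrightarrow> q i (g u) = q i (g v))"
  using assms(2-)
proof (induction n arbitrary: A A' B B' X X')
  case 0
  have fin: "finite A" "finite A'"
    using 0(1,2) by (auto simp: regular_def)
  have card: "card S = card S'"
    if "regular q 0 d S" "regular q 0 d S'" "S \<subseteq> A" "S' \<subseteq> A'" "S = {} \<longleftrightarrow> S' = {}" for d S S'
  proof (cases "S = {}")
    case False
    have "card S = d 0"
      by (rule regular_card_top[OF that(1) False]) (use that 0(14) in blast)
    moreover have "card S' = d 0"
      by (rule regular_card_top[OF that(2)]) (use that False 0(15) in blast)+
    ultimately show ?thesis by simp
  qed (use that in simp)
  have "X \<subseteq> A" "X' \<subseteq> A'" using 0(7-10) by auto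
  then have "card A = card A'" "card B = card B'" "card X = card X'"
    using card[OF 0(1,2)] card[OF 0(3,4)] card[OF 0(5,6)] 0(8,10-13) by simp_all
  then obtain g where g: "bij_betw g A A'" "g ` B = B'" "g ` X = X'"
    using ex_bij_betw_chain[OF fin 0(7-10)] by blast
  moreover have "q 0 u = q 0 v \<longleftrightarrow> q 0 (g u) = q 0 (g v)" if "u \<in> A" "v \<in> A" for u v
    using 0(14)[of u v] 0(15)[of "g u" "g v"] that bij_betwE[OF g(1)] by simp
  ultimately show ?case by (intro exI[of _ g]) simp
next
  case (Suc n)
  have sub: "X \<subseteq> A" "X' \<subseteq> A'" using Suc.prems(7-10) by auto
  have fin: "finite (q n ` A)" "finite (q n ` A')"
    using Suc.prems(1,2) by (auto simp: regular_def)
  have card: "card (q n ` S) = card (q n ` S')"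
    if "regular q (Suc n) d S" "regular q (Suc n) d S'" "S \<subseteq> A" "S' \<subseteq> A'" "S = {} \<longleftrightarrow> S' = {}"
    for d S S'
    by (rule regular_children_card[OF that(1) _ that(2) _ that(5)])
      (use that(3,4) Suc.prems(14,15) in blast)+
  have "card (q n ` A) = card (q n ` A')" "card (q n ` B) = card (q n ` B')"
    "card (q n ` X) = card (q n ` X')"
    using card[OF Suc.prems(1,2)] card[OF Suc.prems(3,4)] card[OF Suc.prems(5,6)] Suc.prems(8,10-13) sub
    by simp_all
  note ex_bij_betw_chain[OF fin Suc.prems(7-10)[THEN image_mono] this]
  then obtain f where f: "bij_betw f (q n ` A) (q n ` A')" "f ` q n ` B = q n ` B'"
    "f ` q n ` X = q n ` X'"
    by (elim exE conjE)
  have fA: "f ` q n ` A = q n ` A'" using f(1) by (simp add: bij_betw_def)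
  define cl where "cl S b = {y \<in> S. q n y = b}" for S b
  \<comment> \<open>The induction hypothesis asks for matching emptiness. As \<open>f\<close> is
    injective on children, \<open>S\<close> meets a child exactly if \<open>S'\<close> meets its
    image.\<close>
  have cl_empty: "cl S b = {} \<longleftrightarrow> cl S' (f b) = {}"
    if "S \<subseteq> A" "f ` q n ` S = q n ` S'" "b \<in> q n ` A" for S S' b
  proof -
    have "b \<in> q n ` S \<longleftrightarrow> f b \<in> f ` q n ` S"
      using inj_on_image_mem_iff[OF bij_betw_imp_inj_on[OF f(1)] that(3) image_mono[OF that(1)]] by simp
    moreover have "cl T d \<noteq> {} \<longleftrightarrow> d \<in> q n ` T" for T d
      by (auto simp: cl_def)
    ultimately show ?thesis using that(2) by metis
  qed
  have cl_mono: "cl S b \<subseteq> cl T b" if "S \<subseteq> T" for S T :: "'a set" and b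
    using that by (auto simp: cl_def)
  have reg: "regular q n d (cl S b)" if "regular q (Suc n) d S" for d S b
    unfolding cl_def using that nested by (rule regular_subclass)
  define iso where "iso b g \<longleftrightarrow>
    bij_betw g (cl A b) (cl A' (f b)) \<and> g ` cl B b = cl B' (f b) \<and> g ` cl X b = cl X' (f b) \<and>
    (\<forall>i\<le>n. \<forall>u\<in>cl A b. \<forall>v\<in>cl A b. q i u = q i v \<longleftrightarrow> q i (g u) = q i (g v))" for b g
  have "\<exists>g. iso b g"
    if b: "b \<in> q n ` A" for b
    unfolding iso_def
    by (rule Suc.IH[OF Suc.prems(1-6)[THEN reg] Suc.prems(7-10)[THEN cl_mono]
          cl_empty[OF order_refl fA b] cl_empty[OF Suc.prems(8) f(2) b] cl_empty[OF sub(1) f(3) b]])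
      (simp_all add: cl_def)
  then have "\<forall>b. \<exists>g. b \<in> q n ` A \<longrightarrow> iso b g" by blast
  then obtain G where iso: "\<forall>b. b \<in> q n ` A \<longrightarrow> iso b (G b)" by (elim choice[THEN exE])
  have G: "bij_betw (G b) (cl A b) (cl A' (f b))" "G b ` cl B b = cl B' (f b)"
    "G b ` cl X b = cl X' (f b)" if "b \<in> q n ` A" for b
    using iso that by (simp_all add: iso_def)
  have G_preserve: "q i u = q i v \<longleftrightarrow> q i (G b u) = q i (G b v)"
    if "b \<in> q n ` A" "i \<le> n" "u \<in> cl A b" "v \<in> cl A b" for b i u v
    using iso[rule_format, OF that(1), unfolded iso_def] that(2-4) by blast
  have GA: "G b ` cl A b = cl A' (f b)" if "b \<in> q n ` A" for b
    using G(1)[OF that] by (simp add: bij_betw_def)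
  define g where "g u = G (q n u) u" for u
  have image: "g ` S = S'"
    if "S \<subseteq> A" "f ` q n ` S = q n ` S'" "\<And>b. b \<in> q n ` A \<Longrightarrow> G b ` cl S b = cl S' (f b)" for S S'
  proof (intro equalityI subsetI)
    fix v assume "v \<in> g ` S"
    then obtain u where "u \<in> S" "v = G (q n u) u" by (auto simp: g_def)
    then have "v \<in> cl S' (f (q n u))"
      using that(1) that(3)[of "q n u"] by (auto simp: cl_def)
    then show "v \<in> S'" by (simp add: cl_def)
  next
    fix v assume v: "v \<in> S'"
    then have "q n v \<in> f ` q n ` S" using that(2) by simp
    then obtain u where u: "u \<in> S" "q n v = f (q n u)" by auto
    then have "v \<in> G (q n u) ` cl S (q n u)"
      using that(1,3) v by (auto simp: cl_def)
    then obtain w where "w \<in> cl S (q n u)" "v = G (q n u) w" by blast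
    then show "v \<in> g ` S" by (intro image_eqI[of _ _ w]) (simp_all add: cl_def g_def)
  qed
  have imA: "g ` A = A'" and imB: "g ` B = B'" and imX: "g ` X = X'"
    using image fA f(2,3) GA G(2,3) Suc.prems(8) sub by auto
  have qg: "q n (g u) = f (q n u)" if "u \<in> A" for u
    using GA[of "q n u"] that by (auto simp: cl_def g_def)
  have inj_f: "f (q n u) = f (q n v) \<longleftrightarrow> q n u = q n v" if "u \<in> A" "v \<in> A" for u v
    using f(1) that by (auto simp: bij_betw_def inj_on_def)
  have inj: "inj_on g A"
  proof (rule inj_onI)
    fix u v assume uv: "u \<in> A" "v \<in> A" "g u = g v"
    then have same: "q n u = q n v" using qg inj_f by metis
    have "inj_on (G (q n u)) (cl A (q n u))" using G(1) uv by (simp add: bij_betw_def)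
    then show "u = v" using uv same by (auto simp: g_def cl_def dest: inj_onD)
  qed
  have preserve: "q i u = q i v \<longleftrightarrow> q i (g u) = q i (g v)"
    if i: "i \<le> Suc n" and u: "u \<in> A" and v: "v \<in> A" for i u v
  proof (cases "i = Suc n")
    case True
    then show ?thesis using u v imA Suc.prems(14,15) by blast
  next
    case False
    then have i: "i \<le> n" using i by simp
    show ?thesis
    proof (cases "q n u = q n v")
      case True
      then show ?thesis using G_preserve[of "q n u" i u v] i u v by (auto simp: g_def cl_def)
    next
      case False
      \<comment> \<open>Distinct children stay distinct under \<open>f\<close>; by nestedness their
        points are separated at all levels up to \<open>n\<close>, both before and after applying
        \<open>g\<close>.\<close>
      then have "q n (g u) \<noteq> q n (g v)" using qg inj_f u v by simp
      then show ?thesis using False nested[OF i] by blast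
    qed
  qed
  show ?case
    using inj imA imB imX preserve by (intro exI[of _ g]) (auto simp: bij_betw_def)
qed

text \<open>The shell is a difference of two nested classes. The double counting applies this both
  to the point set and to a block.\<close>

lemma regular_shell_card:
  assumes B: "regular q n k B" and x: "x \<in> B" and j: "j < n"
    and nested: "\<And>y. q j y = q j x \<Longrightarrow> q (Suc j) y = q (Suc j) x"
  shows "card {z \<in> B. q (Suc j) z = q (Suc j) x \<and> q j z \<noteq> q j x} = k (Suc j) - k j"
proof -
  have "{z \<in> B. q (Suc j) z = q (Suc j) x \<and> q j z \<noteq> q j x} =
      {z \<in> B. q (Suc j) z = q (Suc j) x} - {z \<in> B. q j z = q j x}"
    by blast
  moreover have "{z \<in> B. q j z = q j x} \<subseteq> {z \<in> B. q (Suc j) z = q (Suc j) x}"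
    using nested by blast
  ultimately show ?thesis
    using B x j by (simp add: card_Diff_subset regular_def)
qed

section \<open>The automorphism group of a design\<close>

lemma image_compose_subset: "B \<subseteq> S \<Longrightarrow> compose S g h ` B = g ` h ` B"
  by (force simp: compose_def image_iff)

text \<open>Serves to turn the inclusion of \<open>tree_auts\<close> in the carrier of
  \<open>Aut\<close> into a subgroup statement, by comparing two subgroups of the symmetric
  group.\<close>

lemma subgroup_Aut:
  assumes sub: "\<forall>B\<in>blocks D. B \<subseteq> points D"
  shows "subgroup (carrier (Aut D)) (BijGroup (points D))"
proof (rule group.subgroupI[OF group_BijGroup])
  show "carrier (Aut D) \<subseteq> carrier (BijGroup (points D))"
    by (auto simp: Aut_def BijGroup_def)
  have "(\<lambda>B. (\<lambda>x\<in>points D. x) ` B) ` blocks D = (\<lambda>B. B) ` blocks D"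
    by (rule image_cong[OF refl]) (use sub in force)
  then have "(\<lambda>x\<in>points D. x) \<in> carrier (Aut D)"
    by (simp add: Aut_def id_Bij)
  then show "carrier (Aut D) \<noteq> {}" by blast
  show "inv\<^bsub>BijGroup (points D)\<^esub> g \<in> carrier (Aut D)" if g: "g \<in> carrier (Aut D)" for g
  proof -
    let ?h = "\<lambda>x\<in>points D. inv_into (points D) g x"
    have Bij: "g \<in> Bij (points D)" and im: "(\<lambda>B. g ` B) ` blocks D = blocks D"
      using g by (auto simp: Aut_def)
    have inj: "inj_on g (points D)" "g ` points D = points D"
      using Bij by (auto simp: Bij_def bij_betw_def)
    have "?h ` g ` B = B" if "B \<in> blocks D" for B
    proof -
      have "?h ` g ` B = inv_into (points D) g ` g ` B"
        using inj(2) sub that by (intro image_cong) auto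
      then show ?thesis using inj(1) sub that by (simp add: inv_into_image_cancel)
    qed
    \<comment> \<open>\<open>?h\<close> undoes the action of \<open>g\<close> on blocks; since
      \<open>g\<close> maps \<open>blocks D\<close> onto itself, so does \<open>?h\<close>.\<close>
    then have "(\<lambda>B. ?h ` B) ` (\<lambda>B. g ` B) ` blocks D = (\<lambda>B. B) ` blocks D"
      unfolding image_image[of "\<lambda>B. ?h ` B" "\<lambda>B. g ` B" "blocks D"] by (rule image_cong[OF refl])
    then have "(\<lambda>B. ?h ` B) ` blocks D = blocks D" by (simp add: im)
    then show ?thesis
      using Bij by (simp add: Aut_def inv_BijGroup restrict_inv_into_Bij)
  qed
  show "g \<otimes>\<^bsub>BijGroup (points D)\<^esub> h \<in> carrier (Aut D)"
    if g: "g \<in> carrier (Aut D)" and h: "h \<in> carrier (Aut D)" for g h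
  proof -
    have Bij: "g \<in> Bij (points D)" "h \<in> Bij (points D)"
      using g h by (auto simp: Aut_def)
    have "(\<lambda>B. compose (points D) g h ` B) ` blocks D = (\<lambda>B. g ` B) ` (\<lambda>B. h ` B) ` blocks D"
      unfolding image_image[of "\<lambda>B. g ` B" "\<lambda>B. h ` B" "blocks D"]
      by (rule image_cong[OF refl], rule image_compose_subset) (rule bspec[OF sub])
    then show ?thesis
      using g h Bij by (simp add: Aut_def BijGroup_def compose_Bij)
  qed
qed

section \<open>The design of a class tree and the stabilizer of the tree\<close>

locale class_tree =
  fixes P :: "'a set" and q :: "nat \<Rightarrow> 'a \<Rightarrow> 'b" and n :: nat and c :: "nat \<Rightarrow> nat"
  assumes nested: "\<lbrakk>i \<le> j; q i x = q i y\<rbrakk> \<Longrightarrow> q j x = q j y"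
    and bottom: "inj_on (q 0) P"
    and top: "\<lbrakk>x \<in> P; y \<in> P\<rbrakk> \<Longrightarrow> q n x = q n y"
    and regular_points: "regular q n c P"
    and nonempty: "P \<noteq> {}"
begin

definition tree_auts :: "('a \<Rightarrow> 'a) set" where
  "tree_auts = {g \<in> Bij P. \<forall>i\<le>n. \<forall>x\<in>P. \<forall>y\<in>P. q i x = q i y \<longleftrightarrow> q i (g x) = q i (g y)}"

text \<open>Taking all regular sets makes the block set invariant under \<open>tree_auts\<close>.
  The empty set has to be excluded by hand, being regular for every \<open>k\<close>.\<close>

definition design :: "(nat \<Rightarrow> nat) \<Rightarrow> 'a incidence" where
  "design k = (P, {B. B \<subseteq> P \<and> B \<noteq> {} \<and> regular q n k B})"

lemma points_design [simp]: "points (design k) = P"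
  by (simp add: design_def)

lemma blocks_design: "B \<in> blocks (design k) \<longleftrightarrow> B \<subseteq> P \<and> B \<noteq> {} \<and> regular q n k B"
  by (simp add: design_def)

lemma finite_points: "finite P"
  using regular_points by (simp add: regular_def)

lemma finite_blocks: "finite (blocks (design k))"
  by (rule finite_subset[of _ "Pow P"]) (auto simp: blocks_design finite_points)

lemma tree_autsD:
  assumes "g \<in> tree_auts"
  shows "g \<in> Bij P" "inj_on g P" "g ` P = P" "x \<in> P \<Longrightarrow> g x \<in> P"
    "\<lbrakk>i \<le> n; x \<in> P; y \<in> P\<rbrakk> \<Longrightarrow> q i (g x) = q i (g y) \<longleftrightarrow> q i x = q i y"
  using assms by (auto simp: tree_auts_def Bij_def bij_betw_def)

lemma subgroup_tree_auts: "subgroup tree_auts (BijGroup P)"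
proof (rule group.subgroupI[OF group_BijGroup])
  show "tree_auts \<subseteq> carrier (BijGroup P)"
    by (auto simp: tree_auts_def BijGroup_def)
  have "(\<lambda>x\<in>P. x) \<in> tree_auts" by (simp add: tree_auts_def id_Bij)
  then show "tree_auts \<noteq> {}" by blast
  show "inv\<^bsub>BijGroup P\<^esub> g \<in> tree_auts" if g: "g \<in> tree_auts" for g
  proof -
    note G = tree_autsD[OF g]
    have "q i x = q i y \<longleftrightarrow> q i (inv_into P g x) = q i (inv_into P g y)"
      if "i \<le> n" "x \<in> P" "y \<in> P" for i x y
      using G(5)[of i "inv_into P g x" "inv_into P g y"] that G(3)
      by (simp add: f_inv_into_f inv_into_into)
    then show ?thesis
      using G(1) by (simp add: tree_auts_def inv_BijGroup restrict_inv_into_Bij)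
  qed
  show "g \<otimes>\<^bsub>BijGroup P\<^esub> h \<in> tree_auts" if g: "g \<in> tree_auts" and h: "h \<in> tree_auts" for g h
    using tree_autsD[OF g] tree_autsD[OF h]
    by (simp add: tree_auts_def BijGroup_def compose_Bij compose_eq)
qed

text \<open>The common source of transitivity on points, flags and pairs: \<open>B\<close> is a
  singleton, a block or a pair, and \<open>X\<close> a single point in it.\<close>

lemma ex_tree_aut:
  assumes "regular q n k B" "regular q n k B'" "regular q n m X" "regular q n m X'"
    "X \<subseteq> B" "B \<subseteq> P" "X' \<subseteq> B'" "B' \<subseteq> P" "B = {} \<longleftrightarrow> B' = {}" "X = {} \<longleftrightarrow> X' = {}"
  shows "\<exists>g\<in>tree_auts. g ` B = B' \<and> g ` X = X'"
proof -
  have "\<exists>g. bij_betw g P P \<and> g ` B = B' \<and> g ` X = X' \<and>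
    (\<forall>i\<le>n. \<forall>u\<in>P. \<forall>v\<in>P. q i u = q i v \<longleftrightarrow> q i (g u) = q i (g v))"
    by (rule regular_isomorphism[OF _ regular_points regular_points assms(1-8) refl assms(9,10)];
        rule nested top; assumption)
  then obtain g where g: "bij_betw g P P" "g ` B = B'" "g ` X = X'"
    "\<forall>i\<le>n. \<forall>u\<in>P. \<forall>v\<in>P. q i u = q i v \<longleftrightarrow> q i (g u) = q i (g v)"
    by (elim exE conjE)
  \<comment> \<open>Elements of \<open>Bij P\<close> are extensional, hence the restriction.\<close>
  have "restrict g P \<in> Bij P"
    using g(1) by (simp add: Bij_def cong: bij_betw_cong)
  then have "restrict g P \<in> tree_auts"
    using g(4) by (simp add: tree_auts_def)
  moreover have "restrict g P ` S = g ` S" if "S \<subseteq> P" for S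
    using that by (intro image_cong) auto
  ultimately show ?thesis
    using assms(5,6) g(2,3) by (metis subset_trans)
qed

lemma regular_singleton: "regular q n (\<lambda>_. 1) {x}"
proof -
  have "{y \<in> {x}. q i y = q i x} = {x}" for i by blast
  then show ?thesis by (simp add: regular_def)
qed

lemma tree_auts_transitive:
  assumes "x \<in> P" "y \<in> P"
  shows "\<exists>g\<in>tree_auts. g x = y"
  using ex_tree_aut[OF regular_singleton regular_singleton regular_singleton regular_singleton
      order_refl _ order_refl, of x y] assms by simp

lemma tree_auts_flag_transitive:
  assumes "B \<in> blocks (design k)" "B' \<in> blocks (design k)" "x \<in> B" "x' \<in> B'"
  shows "\<exists>g\<in>tree_auts. g x = x' \<and> g ` B = B'"
  using ex_tree_aut[OF _ _ regular_singleton regular_singleton, of k B B' x x'] assms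
  by (auto simp: blocks_design)

text \<open>Classes of level below \<open>i\<close> separate the two points, those of level
  \<open>i\<close> and above contain both or neither; so a pair is a legitimate input for
  \<open>ex_tree_aut\<close>.\<close>

lemma regular_pair:
  assumes "\<And>j. j \<le> n \<Longrightarrow> q j x = q j y \<longleftrightarrow> i \<le> j" "x \<noteq> y"
  shows "regular q n (\<lambda>j. if i \<le> j then 2 else 1) {x, y}"
proof -
  have "{z \<in> {x, y}. q j z = q j w} = (if i \<le> j then {x, y} else {w})"
    if "j \<le> n" "w = x \<or> w = y" for j w
    using assms(1)[OF that(1)] that(2) by auto
  then show ?thesis using assms(2) by (simp add: regular_def)
qed

text \<open>Mapping the pair to the pair and \<open>x\<close> to \<open>x'\<close> at the same time
  leaves only \<open>y'\<close> as the image of \<open>y\<close>.\<close>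

lemma tree_auts_pair_transitive:
  assumes "x \<in> P" "y \<in> P" "x \<noteq> y" "\<And>j. j \<le> n \<Longrightarrow> q j x = q j y \<longleftrightarrow> i \<le> j"
    and "x' \<in> P" "y' \<in> P" "x' \<noteq> y'" "\<And>j. j \<le> n \<Longrightarrow> q j x' = q j y' \<longleftrightarrow> i \<le> j"
  shows "\<exists>g\<in>tree_auts. g x = x' \<and> g y = y'"
proof -
  obtain g where g: "g \<in> tree_auts" "g ` {x, y} = {x', y'}" "g ` {x} = {x'}"
    using ex_tree_aut[OF regular_pair[OF assms(4,3)] regular_pair[OF assms(8,7)]
        regular_singleton regular_singleton, of x x'] assms by auto
  then have "g y = y'" using assms(7) by (auto simp: doubleton_eq_iff)
  then show ?thesis using g by blast
qed

lemma tree_aut_block: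
  assumes g: "g \<in> tree_auts" and B: "B \<in> blocks (design k)"
  shows "g ` B \<in> blocks (design k)"
proof -
  note G = tree_autsD[OF g]
  have sub: "B \<subseteq> P" and reg: "regular q n k B" using B by (auto simp: blocks_design)
  have "card {y \<in> g ` B. q i y = q i (g x)} = k i" if "i \<le> n" "x \<in> B" for i x
  proof -
    have "{y \<in> g ` B. q i y = q i (g x)} = g ` {y \<in> B. q i y = q i x}"
      using G(5)[OF that(1)] that(2) sub by blast
    moreover have "inj_on g {y \<in> B. q i y = q i x}"
      using sub by (intro inj_on_subset[OF G(2)]) auto
    ultimately show ?thesis
      using reg that by (simp add: card_image regular_def)
  qed
  then have "regular q n k (g ` B)"
    using reg by (simp add: regular_def)
  then show ?thesis using B G(4) by (auto simp: blocks_design)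
qed

text \<open>Blocks go injectively to blocks, and an injective self-map of the finite block set is
  onto.\<close>

lemma tree_auts_subset_Aut: "tree_auts \<subseteq> carrier (Aut (design k))"
proof
  fix g assume g: "g \<in> tree_auts"
  have "inj_on (\<lambda>B. g ` B) (blocks (design k))"
    by (rule inj_onI, rule inj_on_image_eq_iff[THEN iffD1, OF tree_autsD(2)[OF g]])
      (auto simp: blocks_design)
  then have "(\<lambda>B. g ` B) ` blocks (design k) = blocks (design k)"
    using tree_aut_block[OF g] by (intro endo_inj_surj finite_blocks) auto
  then show "g \<in> carrier (Aut (design k))"
    using tree_autsD(1)[OF g] by (simp add: Aut_def)
qed

lemma Aut_tree_auts: "(Aut (design k))\<lparr>carrier := tree_auts\<rparr> = (BijGroup P)\<lparr>carrier := tree_auts\<rparr>"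
  by (simp add: Aut_def)

lemma subgroup_Aut_tree_auts: "subgroup tree_auts (Aut (design k))"
proof -
  have "Aut (design k) = (BijGroup P)\<lparr>carrier := carrier (Aut (design k))\<rparr>"
    by (simp add: Aut_def)
  moreover have "subgroup tree_auts ((BijGroup P)\<lparr>carrier := carrier (Aut (design k))\<rparr>)"
    using subgroup_Aut[of "design k"]
    by (intro group.subgroup_incl[OF group_BijGroup subgroup_tree_auts _ tree_auts_subset_Aut])
      (simp add: blocks_design)
  ultimately show ?thesis by simp
qed

section \<open>The actions on points and flags, and the invariant chain\<close>

lemma transitive_tree_auts:
  "transitive_action ((BijGroup P)\<lparr>carrier := tree_auts\<rparr>) P (\<lambda>g. g)"
proof -
  have "(\<lambda>g. g) \<in> hom ((BijGroup P)\<lparr>carrier := tree_auts\<rparr>) (BijGroup P)"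
    using subgroup.subset[OF subgroup_tree_auts] by (auto simp: hom_def)
  then have "group_hom ((BijGroup P)\<lparr>carrier := tree_auts\<rparr>) (BijGroup P) (\<lambda>g. g)"
    using subgroup.subgroup_is_group[OF subgroup_tree_auts group_BijGroup]
    by (simp add: group_hom_def group_hom_axioms_def group_BijGroup)
  then show ?thesis
    using tree_auts_transitive
    by (simp add: transitive_action_def group_action_def transitive_action_axioms_def)
qed

lemma flag_transitive_tree_auts: "flag_transitive tree_auts (design k)"
proof -
  let ?F = "flags (design k)" and ?\<phi> = "\<lambda>g. \<lambda>F\<in>flags (design k). (g (fst F), g ` snd F)"
  have flags: "F \<in> ?F \<longleftrightarrow> snd F \<in> blocks (design k) \<and> fst F \<in> snd F" for F
    by (cases F) (auto simp: flags_def blocks_design)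
  have sub: "B \<subseteq> P" if "B \<in> blocks (design k)" for B
    using that by (simp add: blocks_design)
  \<comment> \<open>Finiteness of the set of flags makes each injective self-map a
    bijection.\<close>
  have "?F \<subseteq> P \<times> blocks (design k)" by (auto simp: flags_def)
  then have fin: "finite ?F"
    using finite_blocks finite_points by (meson finite_SigmaI finite_subset)
  have closed: "(g (fst F), g ` snd F) \<in> ?F" if "g \<in> tree_auts" "F \<in> ?F" for g F
    using that tree_aut_block by (simp add: flags)
  have Bij: "?\<phi> g \<in> Bij ?F" if g: "g \<in> tree_auts" for g
  proof -
    have "inj_on (?\<phi> g) ?F"
    proof (rule inj_onI)
      fix E F assume EF: "E \<in> ?F" "F \<in> ?F" "?\<phi> g E = ?\<phi> g F"
      then have "g (fst E) = g (fst F)" "g ` snd E = g ` snd F" by auto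
      moreover have "snd E \<subseteq> P" "snd F \<subseteq> P" "fst E \<in> P" "fst F \<in> P"
        using EF(1,2) sub by (auto simp: flags)
      ultimately show "E = F"
        using tree_autsD(2)[OF g] by (simp add: prod_eq_iff inj_on_image_eq_iff inj_on_eq_iff)
    qed
    moreover have "?\<phi> g ` ?F \<subseteq> ?F" using closed[OF g] by auto
    ultimately have "bij_betw (?\<phi> g) ?F ?F"
      using endo_inj_surj[OF fin] by (simp add: bij_betw_def)
    then show ?thesis by (simp add: Bij_def)
  qed
  have mult: "?\<phi> (g \<otimes>\<^bsub>BijGroup P\<^esub> h) = ?\<phi> g \<otimes>\<^bsub>BijGroup ?F\<^esub> ?\<phi> h"
    if g: "g \<in> tree_auts" and h: "h \<in> tree_auts" for g h
  proof -
    have "?\<phi> (compose P g h) = compose ?F (?\<phi> g) (?\<phi> h)"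
    proof
      fix F
      show "?\<phi> (compose P g h) F = compose ?F (?\<phi> g) (?\<phi> h) F"
      proof (cases "F \<in> ?F")
        case True
        then have "snd F \<subseteq> P" "fst F \<in> P" using sub by (auto simp: flags)
        then show ?thesis
          using True closed[OF h True] by (simp add: compose_eq image_compose_subset)
      qed (simp add: compose_def)
    qed
    then show ?thesis
      using tree_autsD(1)[OF g] tree_autsD(1)[OF h] Bij[OF g] Bij[OF h] by (simp add: BijGroup_def)
  qed
  have "?\<phi> \<in> hom ((BijGroup P)\<lparr>carrier := tree_auts\<rparr>) (BijGroup ?F)"
    using Bij mult by (simp add: hom_def BijGroup_def)
  then have "group_hom ((BijGroup P)\<lparr>carrier := tree_auts\<rparr>) (BijGroup ?F) ?\<phi>"
    using subgroup.subgroup_is_group[OF subgroup_tree_auts group_BijGroup]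
    by (simp add: group_hom_def group_hom_axioms_def group_BijGroup)
  moreover have "\<exists>g\<in>tree_auts. ?\<phi> g E = F" if E: "E \<in> ?F" and F: "F \<in> ?F" for E F
  proof -
    obtain g where "g \<in> tree_auts" "g (fst E) = fst F" "g ` snd E = snd F"
      using tree_auts_flag_transitive[of "snd E" k "snd F" "fst E" "fst F"] E F
      by (auto simp: flags)
    then show ?thesis using E by (intro bexI[of _ g]) simp_all
  qed
  ultimately show ?thesis
    unfolding flag_transitive_def Aut_tree_auts
    by (simp add: transitive_action_def group_action_def transitive_action_axioms_def)
qed

definition level :: "nat \<Rightarrow> 'a set set" where
  "level i = (\<lambda>x. {y \<in> P. q i y = q i x}) ` P"

text \<open>Nestedness gives inclusion of the classes, and the growth of their sizes makes it
  proper.\<close>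

lemma chain_imprimitive_tree_auts:
  assumes less: "\<And>i. i < n \<Longrightarrow> c i < c (Suc i)"
  shows "chain_imprimitive n tree_auts P"
proof -
  have "partition_on P (level i)" for i
  proof (rule partition_onI)
    fix C D assume "C \<in> level i" "D \<in> level i" "C \<noteq> D"
    then obtain x y where CD: "C = {z \<in> P. q i z = q i x}" "D = {z \<in> P. q i z = q i y}"
      by (auto simp: level_def)
    with \<open>C \<noteq> D\<close> have "q i x \<noteq> q i y" by metis
    then show "disjnt C D" by (simp add: CD disjnt_iff)
  qed (auto simp: level_def)
  moreover have "(\<lambda>C. g ` C) ` level i = level i" if i: "i \<le> n" and g: "g \<in> tree_auts" for i g
  proof -
    note G = tree_autsD[OF g]
    have "g ` {y \<in> P. q i y = q i x} = {y \<in> P. q i y = q i (g x)}" if x: "x \<in> P" for x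
    proof (intro equalityI subsetI)
      fix z assume z: "z \<in> {y \<in> P. q i y = q i (g x)}"
      then obtain y where y: "y \<in> P" "z = g y" using G(3) by blast
      then show "z \<in> g ` {y \<in> P. q i y = q i x}"
        using z G(5)[OF i y(1) x] by blast
    qed (use G(4) G(5)[OF i _ x] in auto)
    then have "(\<lambda>C. g ` C) ` level i = (\<lambda>x. {y \<in> P. q i y = q i (g x)}) ` P"
      by (simp add: level_def image_image)
    also have "\<dots> = (\<lambda>x. {y \<in> P. q i y = q i x}) ` g ` P"
      by (simp add: image_image)
    finally show ?thesis by (simp add: G(3) level_def)
  qed
  moreover have "level 0 = (\<lambda>x. {x}) ` P"
    unfolding level_def using bottom by (intro image_cong) (auto dest: inj_onD)
  moreover have "level n = {P}"
  proof -
    have "{y \<in> P. q n y = q n x} = P" if "x \<in> P" for x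
      using top[OF _ that] by blast
    then have "level n = (\<lambda>x. P) ` P" unfolding level_def by (intro image_cong) auto
    then show ?thesis using nonempty by auto
  qed
  moreover have "level i \<prec>\<prec> level (Suc i)" if i: "i < n" for i
    unfolding finer_def
  proof
    fix C assume "C \<in> level i"
    then obtain x where x: "x \<in> P" "C = {y \<in> P. q i y = q i x}" by (auto simp: level_def)
    let ?C = "{y \<in> P. q (Suc i) y = q (Suc i) x}"
    have "card C = c i" "card ?C = c (Suc i)"
      using regular_points x i by (auto simp: regular_def)
    then have "C \<noteq> ?C" using less[OF i] by auto
    moreover have "C \<subseteq> ?C"
      unfolding x(2) by (intro Collect_mono impI conjI; elim conjE) (assumption, rule nested[of i], simp_all)
    ultimately have "C \<subset> ?C" by (rule psubsetI[rotated])
    moreover have "?C \<in> level (Suc i)" unfolding level_def using x(1) by (rule imageI)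
    ultimately show "\<exists>C'\<in>level (Suc i). C \<subset> C'" by (rule bexI)
  qed
  ultimately show ?thesis
    unfolding chain_imprimitive_def
    using transitive_tree_auts by (intro conjI exI[of _ level]) blast+
qed

section \<open>Double counting of blocks through pairs of points\<close>

text \<open>An inequality suffices, because transitivity supplies it in both directions. The case
  \<open>x = y\<close> counts the blocks through one point.\<close>

lemma card_blocks_tree_aut_le:
  assumes g: "g \<in> tree_auts" and "x \<in> P" "y \<in> P"
  shows "card {B \<in> blocks (design k). x \<in> B \<and> y \<in> B}
    \<le> card {B \<in> blocks (design k). g x \<in> B \<and> g y \<in> B}"
proof (rule card_inj_on_le)
  show "inj_on (\<lambda>B. g ` B) {B \<in> blocks (design k). x \<in> B \<and> y \<in> B}"
    by (rule inj_onI, rule inj_on_image_eq_iff[THEN iffD1, OF tree_autsD(2)[OF g]])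
      (auto simp: blocks_design)
  show "(\<lambda>B. g ` B) ` {B \<in> blocks (design k). x \<in> B \<and> y \<in> B}
      \<subseteq> {B \<in> blocks (design k). g x \<in> B \<and> g y \<in> B}"
    using tree_aut_block[OF g] by auto
  show "finite {B \<in> blocks (design k). g x \<in> B \<and> g y \<in> B}"
    using finite_blocks by simp
qed

text \<open>Counting the pairs \<open>(y, B)\<close> with \<open>x, y \<in> B\<close> and \<open>y\<close> separated from \<open>x\<close> exactly
  at level \<open>j\<close>: the group permutes these \<open>y\<close> transitively for every \<open>j\<close>, and the hypothesis
  says that a block catches the same fraction \<open>1/t\<close> of them for every \<open>j\<close>.\<close>

lemma two_design_design:
  assumes t: "t > 0" and k: "\<And>j. j < n \<Longrightarrow> k j < k (Suc j)"
    and ck: "\<And>j. j < n \<Longrightarrow> c (Suc j) - c j = t * (k (Suc j) - k j)"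
    and ne: "blocks (design k) \<noteq> {}"
  shows "\<exists>l. two_design (card P) (k n) l (design k)"
proof -
  let ?N = "\<lambda>x y. card {B \<in> blocks (design k). x \<in> B \<and> y \<in> B}"
  have le: "?N x x \<le> ?N y y" if xy: "x \<in> P" "y \<in> P" for x y
  proof -
    obtain g where "g \<in> tree_auts" "g x = y" using tree_auts_transitive[OF xy] by blast
    then show ?thesis using card_blocks_tree_aut_le[of g x x k] xy by simp
  qed
  obtain p where p: "p \<in> P" using nonempty by blast
  \<comment> \<open>\<open>?N p p\<close> is the number r of blocks through any point. The claim is
    t * \<lambda> = r for each pair, whatever the level at which it is joined.\<close>
  have eq: "t * ?N x y = ?N p p" if x: "x \<in> P" and y: "y \<in> P" and xy: "x \<noteq> y" for x y
  proof -
    define i where "i = (LEAST i. q i x = q i y)"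
    have qi: "q i x = q i y" unfolding i_def using top[OF x y] by (rule LeastI)
    have i: "q j x = q j y \<longleftrightarrow> i \<le> j" for j
      using nested[OF _ qi] Least_le[of "\<lambda>i. q i x = q i y" j] unfolding i_def by blast
    \<comment> \<open>Level 0 separates distinct points, so the joining level \<open>i\<close> has a
      predecessor \<open>j\<close>.\<close>
    have "q 0 x \<noteq> q 0 y" using bottom x y xy by (auto dest: inj_onD)
    then obtain j where j: "i = Suc j" using i[of 0] by (cases i) auto
    have jn: "j < n" using i[of n] top[OF x y] j by simp
    \<comment> \<open>The points first joined to \<open>x\<close> at the same level as
      \<open>y\<close>; the group fixing \<open>x\<close> is transitive on them.\<close>
    define T where "T = {z \<in> P. q (Suc j) z = q (Suc j) x \<and> q j z \<noteq> q j x}"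
    have shell: "card {z \<in> B. q (Suc j) z = q (Suc j) x \<and> q j z \<noteq> q j x} = d (Suc j) - d j"
      if "regular q n d B" "x \<in> B" for d B
      using that jn by (rule regular_shell_card) (rule nested[of j], simp_all)
    have N_le: "?N x z \<le> ?N x w" if z: "z \<in> T" and w: "w \<in> T" for z w
    proof -
      have sep: "v \<in> P \<and> x \<noteq> v \<and> (\<forall>m. q m x = q m v \<longleftrightarrow> i \<le> m)" if v: "v \<in> T" for v
      proof -
        have "q m x = q m v \<longleftrightarrow> i \<le> m" for m
        proof
          assume "i \<le> m"
          then show "q m x = q m v" using v j nested[of "Suc j" m v x] by (simp add: T_def)
        next
          assume "q m x = q m v"
          then have "\<not> m \<le> j" using v nested[of m j v x] by (auto simp: T_def)
          then show "i \<le> m" using j by simp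
        qed
        then show ?thesis using v by (auto simp: T_def)
      qed
      obtain g where "g \<in> tree_auts" "g x = x" "g z = w"
        using tree_auts_pair_transitive[of x z i x w] sep[OF z] sep[OF w] x by metis
      then show ?thesis
        using card_blocks_tree_aut_le[of g x z k] sep[OF z] x by simp
    qed
    have yT: "y \<in> T"
      using y i[of j] i[of "Suc j"] j by (auto simp: T_def)
    have N_eq: "?N x z = ?N x y" if "z \<in> T" for z
      using N_le[OF that yT] N_le[OF yT that] by simp
    have card_T: "card T = t * (k (Suc j) - k j)"
      using shell[OF regular_points x] ck[OF jn] by (simp add: T_def)
    have "(\<Sum>z\<in>T. card {B \<in> {B \<in> blocks (design k). x \<in> B}. z \<in> B})
        = (k (Suc j) - k j) * card {B \<in> blocks (design k). x \<in> B}"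
    proof (rule sum_multicount)
      show "finite T" using finite_points by (simp add: T_def)
      show "finite {B \<in> blocks (design k). x \<in> B}" using finite_blocks by simp
      show "\<forall>B\<in>{B \<in> blocks (design k). x \<in> B}. card {z \<in> T. z \<in> B} = k (Suc j) - k j"
      proof
        fix B assume B: "B \<in> {B \<in> blocks (design k). x \<in> B}"
        then have "{z \<in> T. z \<in> B} = {z \<in> B. q (Suc j) z = q (Suc j) x \<and> q j z \<noteq> q j x}"
          by (auto simp: T_def blocks_design)
        then show "card {z \<in> T. z \<in> B} = k (Suc j) - k j"
          using shell[of k B] B by (simp add: blocks_design)
      qed
    qed
    moreover have "(\<Sum>z\<in>T. card {B \<in> {B \<in> blocks (design k). x \<in> B}. z \<in> B}) = card T * ?N x y"
    proof -
      have "{B \<in> {B \<in> blocks (design k). x \<in> B}. z \<in> B} = {B \<in> blocks (design k). x \<in> B \<and> z \<in> B}" for z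
        by blast
      then show ?thesis using N_eq by simp
    qed
    moreover have "(k (Suc j) - k j) * (t * ?N x y) = card T * ?N x y"
      by (simp only: card_T mult_ac)
    ultimately have "(k (Suc j) - k j) * (t * ?N x y) =
        (k (Suc j) - k j) * card {B \<in> blocks (design k). x \<in> B}"
      by (simp only:)
    then have "t * ?N x y = ?N x x" using k[OF jn] by simp
    then show ?thesis using le[OF x p] le[OF p x] by simp
  qed
  \<comment> \<open>By \<open>eq\<close> this division is exact.\<close>
  have "?N x y = ?N p p div t" if "x \<in> P" "y \<in> P" "x \<noteq> y" for x y
    unfolding eq[OF that, symmetric] using t by simp
  moreover have "card B = k n" if B: "B \<in> blocks (design k)" for B
  proof (rule regular_card_top[of q n k])
    show "q n x = q n y" if "x \<in> B" "y \<in> B" for x y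
      by (rule top) (use B that in \<open>auto simp: blocks_design\<close>)
  qed (use B in \<open>simp_all add: blocks_design\<close>)
  ultimately have "two_design (card P) (k n) (?N p p div t) (design k)"
    unfolding two_design_def points_design using ne finite_points by (auto simp: blocks_design)
  then show ?thesis by blast
qed

end

section \<open>Class trees of numbers in mixed radix notation\<close>

text \<open>The numbers with \<open>n\<close> digits for the place values \<open>c\<close> whose
  digit at place \<open>i\<close> is below \<open>y i\<close>. Maximal bounds yield the point set,
  smaller ones a sample block.\<close>

primrec digit_sums :: "(nat \<Rightarrow> nat) \<Rightarrow> (nat \<Rightarrow> nat) \<Rightarrow> nat \<Rightarrow> nat set" where
  "digit_sums c y 0 = {0}"
| "digit_sums c y (Suc n) = (\<lambda>(a, b). a * c n + b) ` ({..<y n} \<times> digit_sums c y n)"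

lemma zero_in_digit_sums: "(\<And>i. 0 < y i) \<Longrightarrow> 0 \<in> digit_sums c y n"
proof (induction n)
  case (Suc n)
  then have "(0, 0) \<in> {..<y n} \<times> digit_sums c y n" by simp
  then show ?case by force
qed simp

locale mixed_radix =
  fixes c e :: "nat \<Rightarrow> nat"
  assumes c0: "c 0 = 1" and cSuc: "c (Suc i) = c i * e i" and e_pos: "0 < e i"
begin

lemma c_pos: "0 < c i"
  by (induction i) (simp_all add: c0 cSuc e_pos)

lemma c_dvd: "i \<le> j \<Longrightarrow> c i dvd c j"
  by (induction j rule: dec_induct) (simp_all add: cSuc)

lemma div_nested:
  assumes "i \<le> j" "x div c i = z div c i"
  shows "x div c j = z div c j"
proof -
  obtain d where "c j = c i * d" using c_dvd[OF assms(1)] by (rule dvdE)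
  then show ?thesis using assms(2) by (simp add: div_mult2_eq)
qed

lemma digit_sums_below:
  assumes "\<And>i. y i \<le> e i"
  shows "digit_sums c y n \<subseteq> {..<c n}"
proof (induction n)
  case 0
  then show ?case by (simp add: c0)
next
  case (Suc n)
  have "a * c n + b < c (Suc n)" if "a < y n" "b \<in> digit_sums c y n" for a b
  proof -
    have "a * c n + b < Suc a * c n" using Suc that(2) by auto
    also have "\<dots> \<le> e n * c n" using that(1) assms[of n] by (intro mult_right_mono) simp_all
    finally show ?thesis by (simp add: cSuc mult.commute)
  qed
  then show ?case by auto
qed

text \<open>Equal quotients by \<open>c j\<close> mean equal digits from place \<open>j\<close> on.
  The \<open>j\<close> lower digits remain free, and the product of their bounds is
  \<open>k j\<close>.\<close>

lemma regular_digit_sums: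
  assumes y: "\<And>i. y i \<le> e i" and k0: "k 0 = 1" and kSuc: "\<And>i. k (Suc i) = k i * y i"
  shows "regular (\<lambda>i x. x div c i) n k (digit_sums c y n)"
proof (induction n)
  case 0
  have "{x. x = 0 \<and> x div c 0 = 0 div c 0} = {0}" by auto
  then show ?case by (simp add: regular_def k0)
next
  case (Suc n)
  let ?D = "digit_sums c y n" and ?D' = "digit_sums c y (Suc n)"
  have below: "b < c n" if "b \<in> ?D" for b
    using digit_sums_below[OF y] that by blast
  have quotient: "(a * c n + b) div c n = a" if "b \<in> ?D" for a b
    using below[OF that] c_pos[of n] by simp
  have fin: "finite ?D" using Suc by (simp add: regular_def)
  have top: "b div c n = b' div c n" if "b \<in> ?D" "b' \<in> ?D" for b b'
    using that[THEN below] by simp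
  show ?case
    unfolding regular_def
  proof (intro conjI allI impI ballI)
    show "finite ?D'" using fin by simp
    fix j x assume j: "j \<le> Suc n" and "x \<in> ?D'"
    then obtain a b where ab: "a < y n" "b \<in> ?D" "x = a * c n + b" by auto
    show "card {z \<in> ?D'. z div c j = x div c j} = k j"
    proof (cases "j = Suc n")
      case True
      have "z div c j = 0" if "z \<in> ?D'" for z
        using digit_sums_below[OF y] that True by (intro div_less) blast
      then have "{z \<in> ?D'. z div c j = x div c j} = ?D'"
        using \<open>x \<in> ?D'\<close> by auto
      moreover have "inj_on (\<lambda>(a, b). a * c n + b) ({..<y n} \<times> ?D)"
      proof (rule inj_onI, clarify)
        fix a b a' b' assume "b \<in> ?D" "b' \<in> ?D" and eq: "a * c n + b = a' * c n + b'"
        then have "a = a'" using quotient by metis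
        then show "a = a' \<and> b = b'" using eq by simp
      qed
      moreover have "card ?D = k n"
        by (rule regular_card_top[OF Suc]) (use ab(2) top in blast)+
      ultimately show ?thesis
        using True by (simp add: card_image card_cartesian_product kSuc mult.commute)
    next
      case False
      then have jn: "j \<le> n" using j by simp
      obtain d where d: "c n = c j * d" using c_dvd[OF jn] by (rule dvdE)
      have shift: "(a * c n + b') div c j = a * d + b' div c j" for a b'
      proof -
        have "(a * c n + b') div c j = (b' + (a * d) * c j) div c j"
          by (simp add: d mult_ac add.commute)
        then show ?thesis using c_pos[of j] by simp
      qed
      \<comment> \<open>For \<open>j\<close> at most \<open>n\<close> the class fixes the leading
        digit \<open>a\<close>, so it is a translate of a class of the shorter digit sums.\<close>
      have "{z \<in> ?D'. z div c j = x div c j} = (\<lambda>b'. a * c n + b') ` {b' \<in> ?D. b' div c j = b div c j}"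
        (is "?L = ?R")
      proof (intro equalityI subsetI)
        fix z assume z: "z \<in> ?L"
        then obtain a' b' where ab': "b' \<in> ?D" "z = a' * c n + b'" by auto
        have "z div c n = x div c n" using div_nested[OF jn, of z x] z by blast
        then have "a' = a" using quotient ab ab' by simp
        then show "z \<in> ?R" using z ab ab' by (simp add: shift)
      next
        fix z assume "z \<in> ?R"
        then obtain b' where "b' \<in> ?D" "b' div c j = b div c j" "z = a * c n + b'" by auto
        then show "z \<in> ?L" using ab by (auto simp: shift)
      qed
      then have "card {z \<in> ?D'. z div c j = x div c j} = card {b' \<in> ?D. b' div c j = b div c j}"
        by (simp add: card_image)
      then show ?thesis using Suc ab(2) jn by (simp add: regular_def)
    qed
  qed
qed

text \<open>By counting: regularity gives the digit sums \<open>c n\<close> elements, all below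
  \<open>c n\<close>.\<close>

lemma digit_sums_full: "digit_sums c e n = {..<c n}"
proof (rule card_subset_eq)
  show sub: "digit_sums c e n \<subseteq> {..<c n}" by (rule digit_sums_below) simp
  have "card (digit_sums c e n) = c n"
  proof (rule regular_card_top[of "\<lambda>i x. x div c i" n c])
    show "regular (\<lambda>i x. x div c i) n c (digit_sums c e n)"
      by (rule regular_digit_sums) (simp_all add: c0 cSuc)
    show "digit_sums c e n \<noteq> {}" using zero_in_digit_sums[of e c n] e_pos by blast
    show "x div c n = z div c n" if "x \<in> digit_sums c e n" "z \<in> digit_sums c e n" for x z
      using that sub by (auto simp: subset_iff)
  qed
  then show "card (digit_sums c e n) = card {..<c n}" by simp
qed simp

lemma class_tree: "class_tree {..<c n} (\<lambda>i x. x div c i) n c"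
proof
  show "x div c j = y div c j" if "i \<le> j" "x div c i = y div c i" for i j x y
    using that by (rule div_nested)
  show "inj_on (\<lambda>x. x div c 0) {..<c n}" by (simp add: c0 inj_on_def)
  show "x div c n = y div c n" if "x \<in> {..<c n}" "y \<in> {..<c n}" for x y
    using that by simp
  show "regular (\<lambda>i x. x div c i) n c {..<c n}"
    using regular_digit_sums[of e c n] by (simp add: digit_sums_full c0 cSuc)
  show "{..<c n} \<noteq> {}" using c_pos[of n] by auto
qed

end

section \<open>Class sizes and block sizes\<close>

text \<open>The sizes are chosen so that \<open>class_size t i - 1 = t * (block_size t i - 1)\<close> for all \<open>i\<close>.
  With \<open>c = class_size t i\<close>, this relation makes \<open>class_size t (Suc i)\<close> congruent to
  \<open>(t - 1) * (y - 1)\<close> modulo \<open>c\<close> when blocks meet \<open>y\<close> subclasses; \<open>y = c + 1\<close> makes it a multiple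
  of \<open>c\<close>.\<close>

primrec class_size :: "nat \<Rightarrow> nat \<Rightarrow> nat" where
  "class_size t 0 = 1"
| "class_size t (Suc i) = class_size t i * (class_size t i + t)"

primrec block_size :: "nat \<Rightarrow> nat \<Rightarrow> nat" where
  "block_size t 0 = 1"
| "block_size t (Suc i) = block_size t i * (class_size t i + 1)"

text \<open>The relation between the two sizes, stated without subtraction of natural
  numbers.\<close>

lemma class_size_block_size: "class_size t i + t = 1 + t * block_size t i"
proof (induction i)
  case (Suc i)
  have "class_size t (Suc i) + t = class_size t i * (1 + t * block_size t i) + t"
    using Suc by simp
  also have "\<dots> = (class_size t i + t) + class_size t i * (t * block_size t i)"
    by (simp add: algebra_simps)
  also have "\<dots> = 1 + t * block_size t (Suc i)"
    unfolding Suc by (simp add: algebra_simps)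
  finally show ?case .
qed simp

lemma class_size_pos: "0 < t \<Longrightarrow> 0 < class_size t i"
  by (induction i) simp_all

lemma block_size_pos: "0 < block_size t i"
  by (induction i) simp_all

lemma block_size_less: "0 < t \<Longrightarrow> block_size t i < block_size t (Suc i)"
  using block_size_pos[of t i] class_size_pos[of t i] by simp

text \<open>Subtracting two instances of \<open>class_size_block_size\<close> gives the hypothesis
  \<open>ck\<close> of the double counting.\<close>

lemma class_size_diff:
  "class_size t (Suc i) - class_size t i = t * (block_size t (Suc i) - block_size t i)"
proof -
  have "class_size t (Suc i) - class_size t i = (class_size t (Suc i) + t) - (class_size t i + t)"
    by (rule diff_cancel2[symmetric])
  also have "\<dots> = t * block_size t (Suc i) - t * block_size t i"
    unfolding class_size_block_size by (rule diff_cancel)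
  finally show ?thesis by (simp only: diff_mult_distrib2)
qed

lemma class_size_mono: "t \<le> t' \<Longrightarrow> class_size t i \<le> class_size t' i"
  by (induction i) (simp_all add: mult_le_mono)

text \<open>Distinguishes the designs for different \<open>t\<close> by their numbers of points.
  Level 0 is left out since its classes have size 1 for every \<open>t\<close>.\<close>

lemma class_size_strict_mono:
  assumes "0 < t" "t < t'"
  shows "class_size t (Suc i) < class_size t' (Suc i)"
proof -
  have le: "class_size t i \<le> class_size t' i" using assms by (intro class_size_mono) simp
  have "class_size t (Suc i) < class_size t i * (class_size t' i + t')"
    using le assms class_size_pos[of t i] by simp
  also have "\<dots> \<le> class_size t' (Suc i)" using le by simp
  finally show ?thesis .
qed

section \<open>Infinitely many designs for each \<open>s\<close>\<close>

lemma ex_chain_imprimitive_design: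
  assumes t: "2 \<le> t" and s: "0 < s"
  shows "\<exists>D :: nat incidence. card (points D) = class_size t s \<and>
    (\<exists>v k l. two_design v k l D \<and> 2 \<le> k \<and> k < card (points D)) \<and>
    (\<exists>G. subgroup G (Aut D) \<and> flag_transitive G D \<and> chain_imprimitive s G (points D))"
proof -
  let ?c = "class_size t" and ?k = "block_size t"
  interpret mixed_radix ?c "\<lambda>i. ?c i + t"
    using t by unfold_locales auto
  interpret class_tree "{..<?c s}" "\<lambda>i x. x div ?c i" s ?c
    by (rule class_tree)
  \<comment> \<open>A sample block: it meets \<open>?c i + 1\<close> of the \<open>?c i + t\<close>
    children of each class of level \<open>i + 1\<close> that it meets.\<close>
  let ?B = "digit_sums ?c (\<lambda>i. ?c i + 1) s"
  have "?B \<subseteq> {..<?c s}" using t by (intro digit_sums_below) simp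
  moreover have "regular (\<lambda>i x. x div ?c i) s ?k ?B"
    using t by (intro regular_digit_sums) simp_all
  moreover have "?B \<noteq> {}" using zero_in_digit_sums[of "\<lambda>i. ?c i + 1" ?c s] by auto
  ultimately have ne: "blocks (design ?k) \<noteq> {}"
    using blocks_design[of ?B ?k] by blast
  have k_less: "?k j < ?k (Suc j)" for j using t by (intro block_size_less) simp
  have "0 < t" using t by simp
  then obtain l where l: "two_design (card {..<?c s}) (?k s) l (design ?k)"
    using two_design_design[of t ?k] k_less class_size_diff ne by blast
  obtain r where "s = Suc r" using s by (cases s) auto
  then have k2: "2 \<le> ?k s" using k_less[of r] block_size_pos[of t r] by (simp del: block_size.simps)
  \<comment> \<open>The size relation reads c = 1 + t * (k - 1), which exceeds k because t and k are
    at least 2; the substitution avoids subtraction.\<close>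
  obtain u w where "t = u + 2" "?k s = w + 2"
    using t k2 by (metis le_add_diff_inverse2)
  then have "?k s < ?c s" using class_size_block_size[of t s] by (simp add: algebra_simps)
  moreover have "?c j < ?c (Suc j)" for j
    using class_size_diff[of t j] k_less[of j] t by (metis mult_pos_pos zero_less_diff \<open>0 < t\<close>)
  ultimately show ?thesis
    using l k2 subgroup_Aut_tree_auts flag_transitive_tree_auts chain_imprimitive_tree_auts
    by (intro exI[of _ "design ?k"]) auto
qed

theorem theorem1p1:
  fixes s :: nat
  assumes "s \<ge> 2"
  shows "\<exists>\<D> :: nat incidence set.
           infinite \<D> \<and>
           pairwise (\<lambda>D D'. \<not> design_isomorphic D D') \<D> \<and>
           (\<forall>D \<in> \<D>.
              (\<exists>v k l. two_design v k l D \<and> 2 \<le> k \<and> k < card (points D)) \<and>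
              (\<exists>G. subgroup G (Aut D) \<and>
                   flag_transitive G D \<and>
                   chain_imprimitive s G (points D)))"
proof -
  define good :: "nat incidence \<Rightarrow> bool" where "good D \<longleftrightarrow>
      (\<exists>v k l. two_design v k l D \<and> 2 \<le> k \<and> k < card (points D)) \<and>
      (\<exists>G. subgroup G (Aut D) \<and> flag_transitive G D \<and> chain_imprimitive s G (points D))" for D
  \<comment> \<open>The shift by 2 makes every index \<open>m\<close> give an admissible parameter
    \<open>t\<close>.\<close>
  have "\<forall>m. \<exists>D. card (points D) = class_size (m + 2) s \<and> good D"
    unfolding good_def using assms by (intro allI ex_chain_imprimitive_design) simp_all
  then obtain D where D: "\<And>m. card (points (D m)) = class_size (m + 2) s" "\<And>m. good (D m)"
    by metis
  obtain r where r: "s = Suc r" using assms by (cases s) auto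
  have "strict_mono (\<lambda>m. class_size (m + 2) s)"
    unfolding r by (rule strict_monoI, rule class_size_strict_mono) simp_all
  then have inj: "inj (\<lambda>m. card (points (D m)))"
    unfolding D(1) by (rule strict_mono_imp_inj_on)
  have "infinite (range D)"
  proof -
    have "inj D" using inj by (auto simp: inj_def)
    then show ?thesis using finite_imageD infinite_UNIV_nat by blast
  qed
  moreover have "pairwise (\<lambda>D D'. \<not> design_isomorphic D D') (range D)"
  proof (rule pairwiseI, rule notI)
    fix E E' assume "E \<in> range D" "E' \<in> range D" "E \<noteq> E'" "design_isomorphic E E'"
    then obtain m m' where "E = D m" "E' = D m'" "card (points E) = card (points E')"
      by (auto simp: design_isomorphic_def dest: bij_betw_same_card)
    then show False using injD[OF inj] \<open>E \<noteq> E'\<close> by blast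
  qed
  ultimately show ?thesis
    using D(2) unfolding good_def by (intro exI[of _ "range D"]) blast
qed

end
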